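(* Two ASP programs with weak constraints $P$ and $Q$ are strongly equivalent if and only if their LPMLN translations $\tau^c(P)$ and $\tau^c(Q)$ are sp-strongly equivalent (p-strongly equivalent under the soft stable model semantics).
   Context: A literal is an atom $a$ or its classical negation $\neg a$. An ASP rule $r$ has the form $l_1\vee\cdots\vee l_k\leftarrow l_{k+1},\dots,l_m,\ not\ l_{m+1},\dots,\ not\ l_n$ with literals $l_i$; $h(r)$, $b^+(r)$, $b^-(r)$ are the head, positive body and negative body literal sets, and $body(r)$ denotes $l_{k+1},\dots,l_m,not\ l_{m+1},\dots,not\ l_n$. An interpretation is a set of literals not containing both $a$ and $\neg a$ for any atom $a$. $I\models r$ iff ($b^+(r)\subseteq I$ and $b^-(r)\cap I=\emptyset$) implies $h(r)\cap I\neq\emptyset$. For an ASP program $\Pi$ (finite set of ground rules) the GL-reduct is $\Pi^I=\{h(r)\leftarrow b^+(r) : r\in\Pi,\ b^-(r)\cap I=\emptyset\}$, and $I$ is a stable model of $\Pi$ iff $I\models\Pi^I$ and no proper subset of $I$ satisfies $\Pi^I$. An ASP program with weak constraints $P$ is a finite set consisting of ASP rules (the set $P^r$) and weak constraints $:\sim body(r).\ [w]$ with $w$ a real penalty (the set $P^c$). $X$ is a stable model of $P$ iff it is a stable model of $P^r$; $Penalty(P,X)$ is the sum of the penalties of the weak constraints in $P^c$ whose bodies are satisfied by $X$. Such programs $P,Q$ are strongly equivalent iff for every ASP program with weak constraints $R$, $P\cup R$ and $Q\cup R$ have the same stable models, and for all stable models $X,Y$ of $P\cup R$, $Penalty(P\cup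 R,X)-Penalty(P\cup R,Y)=Penalty(Q\cup R,X)-Penalty(Q\cup R,Y)$. An LPMLN program is a finite set of weighted rules $w:r$, $r$ an ASP rule, $w$ a real number (soft) or the symbol $\alpha$ (hard); $\overline{P}$, $P^s$, $P^h$, $P_I=\{w:r\in P: I\models r\}$ as usual; $I$ is a stable model of an LPMLN program $P$ iff it is a stable model of $\overline{P_I}$; a soft stable model is a stable model satisfying all hard rules; $\mathrm{SSM}(P)$ is their set; $W_s(P,X)=\exp(\sum_{w:r\in P^s,X\models r}w)$, $Pr_s(P,X)=W_s(P,X)/\sum_{X'\in\mathrm{SSM}(P)}W_s(P,X')$. LPMLN programs $P,Q$ are sp-strongly equivalent iff for every LPMLN program $R$, $\mathrm{SSM}(P\cup R)=\mathrm{SSM}(Q\cup R)$ and $Pr_s(P\cup R,X)=Pr_s(Q\cup R,X)$ for all $X\in\mathrm{SSM}(P\cup R)$. The translation is $\tau^c(P)=\{\alpha:r \mid r\in P^r\}\cup\{w:\ \leftarrow body(r). \mid (:\sim body(r).\ [w])\in P^c\}$.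
   Formalization: The set of atoms from which programs are built is assumed to be infinite, so that fresh atoms are always available; over a finite non-empty set of atoms the equivalence fails. *)

theory Defs
  imports Complex_Main "HOL-Library.FSet"
begin

datatype 'a literal = Pos 'a | Neg 'a

text \<open>\<open>Neg\<close> is classical negation. Default negation \<open>not\<close> is encoded by
  membership in the negative body. Heads and bodies are finite sets of literals, and each of
  them may be empty.\<close>

datatype 'a rule =
  Rule (head: "'a literal fset") (pbody: "'a literal fset") (nbody: "'a literal fset")

definition interpretation_set :: "'a literal set \<Rightarrow> bool" where
  "interpretation_set I \<longleftrightarrow> (\<forall>a. \<not> (Pos a \<in> I \<and> Neg a \<in> I))"

definition sat_body :: "'a literal set \<Rightarrow> 'a literal fset \<Rightarrow> 'a literal fset \<Rightarrow> bool" where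
  "sat_body I p n \<longleftrightarrow> fset p \<subseteq> I \<and> fset n \<inter> I = {}"

definition sat_rule :: "'a literal set \<Rightarrow> 'a rule \<Rightarrow> bool" where
  "sat_rule I r \<longleftrightarrow> (sat_body I (pbody r) (nbody r) \<longrightarrow> fset (head r) \<inter> I \<noteq> {})"

definition sat_program :: "'a literal set \<Rightarrow> 'a rule set \<Rightarrow> bool" where
  "sat_program I \<Pi> \<longleftrightarrow> (\<forall>r\<in>\<Pi>. sat_rule I r)"

definition reduct :: "'a rule set \<Rightarrow> 'a literal set \<Rightarrow> 'a rule set" where
  "reduct \<Pi> I = {Rule (head r) (pbody r) {||} | r. r \<in> \<Pi> \<and> fset (nbody r) \<inter> I = {}}"

definition stable_model :: "'a rule set \<Rightarrow> 'a literal set \<Rightarrow> bool" where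
  "stable_model \<Pi> I \<longleftrightarrow>
     interpretation_set I \<and> sat_program I (reduct \<Pi> I) \<and>
     (\<forall>J. J \<subset> I \<longrightarrow> \<not> sat_program J (reduct \<Pi> I))"


section \<open>ASP programs with weak constraints\<close>

text \<open>\<open>Weak p n w\<close> is the weak constraint with positive body \<open>p\<close>, negative body \<open>n\<close> and
  penalty \<open>w\<close>. Programs are sets, so the union of two programs identifies a weak constraint
  occurring in both.\<close>

datatype 'a statement =
  Regular "'a rule" | Weak "'a literal fset" "'a literal fset" real

definition regular_part :: "'a statement set \<Rightarrow> 'a rule set" where
  "regular_part P = {r. Regular r \<in> P}"

definition weak_part :: "'a statement set \<Rightarrow> ('a literal fset \<times> 'a literal fset \<times> real) set" where
  "weak_part P = {(p, n, w). Weak p n w \<in> P}"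

definition stable_model_wc :: "'a statement set \<Rightarrow> 'a literal set \<Rightarrow> bool" where
  "stable_model_wc P X \<longleftrightarrow> stable_model (regular_part P) X"

definition penalty :: "'a statement set \<Rightarrow> 'a literal set \<Rightarrow> real" where
  "penalty P X = (\<Sum>(p, n, w) \<in> {(p, n, w) \<in> weak_part P. sat_body X p n}. w)"

definition strongly_equivalent_wc :: "'a statement set \<Rightarrow> 'a statement set \<Rightarrow> bool" where
  "strongly_equivalent_wc P Q \<longleftrightarrow>
     (\<forall>R. finite R \<longrightarrow>
        (\<forall>X. stable_model_wc (P \<union> R) X \<longleftrightarrow> stable_model_wc (Q \<union> R) X) \<and>
        (\<forall>X Y. stable_model_wc (P \<union> R) X \<and> stable_model_wc (P \<union> R) Y \<longrightarrow>
           penalty (P \<union> R) X - penalty (P \<union> R) Y = penalty (Q \<union> R) X - penalty (Q \<union> R) Y))"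


section \<open>LPMLN programs\<close>

text \<open>\<open>Hard\<close> is the symbolic weight \<open>\<alpha>\<close>.\<close>

datatype weight = Soft real | Hard

type_synonym 'a lpmln = "(weight \<times> 'a rule) set"

definition unweighted :: "'a lpmln \<Rightarrow> 'a rule set" where
  "unweighted P = snd ` P"

definition soft_part :: "'a lpmln \<Rightarrow> (real \<times> 'a rule) set" where
  "soft_part P = {(w, r). (Soft w, r) \<in> P}"

definition hard_part :: "'a lpmln \<Rightarrow> 'a rule set" where
  "hard_part P = {r. (Hard, r) \<in> P}"

definition satisfied_part :: "'a lpmln \<Rightarrow> 'a literal set \<Rightarrow> 'a lpmln" where
  "satisfied_part P I = {(w, r) \<in> P. sat_rule I r}"

definition stable_model_lpmln :: "'a lpmln \<Rightarrow> 'a literal set \<Rightarrow> bool" where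
  "stable_model_lpmln P I \<longleftrightarrow> stable_model (unweighted (satisfied_part P I)) I"

definition SSM :: "'a lpmln \<Rightarrow> 'a literal set set" where
  "SSM P = {I. stable_model_lpmln P I \<and> sat_program I (hard_part P)}"

definition W_s :: "'a lpmln \<Rightarrow> 'a literal set \<Rightarrow> real" where
  "W_s P X = exp (\<Sum>(w, r) \<in> {(w, r) \<in> soft_part P. sat_rule X r}. w)"

text \<open>For finite \<open>P\<close> the set \<open>SSM P\<close> is finite, since every stable model consists of
  literals occurring in heads of \<open>P\<close>; hence the normalising sum is a genuine one.\<close>

definition Pr_s :: "'a lpmln \<Rightarrow> 'a literal set \<Rightarrow> real" where
  "Pr_s P X = W_s P X / (\<Sum>X' \<in> SSM P. W_s P X')"

definition sp_strongly_equivalent :: "'a lpmln \<Rightarrow> 'a lpmln \<Rightarrow> bool" where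
  "sp_strongly_equivalent P Q \<longleftrightarrow>
     (\<forall>R. finite R \<longrightarrow>
        SSM (P \<union> R) = SSM (Q \<union> R) \<and>
        (\<forall>X \<in> SSM (P \<union> R). Pr_s (P \<union> R) X = Pr_s (Q \<union> R) X))"

definition tau_c :: "'a statement set \<Rightarrow> 'a lpmln" where
  "tau_c P =
     {(Hard, r) | r. r \<in> regular_part P} \<union>
     {(Soft w, Rule {||} p n) | p n w. (p, n, w) \<in> weak_part P}"

end

theory Submission
  imports Defs
begin

text \<open>
  A constraint satisfied by \<open>I\<close> does not affect whether \<open>I\<close> is stable, so the soft stable models of
  \<open>\<tau>\<^sup>c(P) \<union> R\<close> are determined by the rules of \<open>P\<close> and by \<open>R\<close>; moreover the soft weight is
  \<open>exp (K - penalty)\<close> up to a factor that depends on \<open>R\<close> only. Hence equality of the probabilities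
  amounts to equality of the penalty differences. The difficulty is that two soft stable models
  \<open>X\<close>, \<open>Y\<close> of \<open>\<tau>\<^sup>c(P) \<union> R\<close> may rely on different subsets of \<open>R\<close>, so that
  possibly no single extension of \<open>P\<close> by rules of \<open>R\<close> has both as stable models.
  Two fresh atoms \<open>b\<close>, \<open>c\<close> repair this: with the rules
  \<open>b \<leftarrow> not c\<close>, \<open>c \<leftarrow> not b\<close>, \<open>x \<leftarrow> b\<close> for \<open>x \<in> X\<close>, and \<open>y \<leftarrow> c\<close> for \<open>y \<in> Y\<close>,
  both \<open>X \<union> {b}\<close> and \<open>Y \<union> {c}\<close> are stable, and they have the penalties of \<open>X\<close> and \<open>Y\<close>.
\<close>

section \<open>Stable models\<close>

lemma sat_program_Un [simp]: "sat_program I (A \<union> B) \<longleftrightarrow> sat_program I A \<and> sat_program I B"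
  by (auto simp: sat_program_def)

lemma reduct_Un: "reduct (A \<union> B) I = reduct A I \<union> reduct B I"
  by (auto simp: reduct_def)

lemma sat_program_reduct_iff:
  "sat_program J (reduct A I) \<longleftrightarrow>
     (\<forall>r\<in>A. fset (nbody r) \<inter> I = {} \<longrightarrow> fset (pbody r) \<subseteq> J \<longrightarrow> fset (head r) \<inter> J \<noteq> {})"
  unfolding sat_program_def reduct_def sat_rule_def sat_body_def by fastforce

lemma sat_program_reduct_self: "sat_program I (reduct A I) \<longleftrightarrow> sat_program I A"
  unfolding sat_program_reduct_iff by (auto simp: sat_program_def sat_rule_def sat_body_def)

lemma stable_model_imp_sat: "stable_model A I \<Longrightarrow> sat_program I A"
  unfolding stable_model_def sat_program_reduct_self by (elim conjE)

text \<open>A satisfied constraint has a false body at \<open>I\<close>: either the reduct drops it,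
  or its positive body is not contained in \<open>I\<close>, hence in no subset of \<open>I\<close>.
  It thus never excludes a smaller model.\<close>

lemma stable_model_Un_constraints:
  assumes "\<And>r. r \<in> C \<Longrightarrow> head r = {||} \<and> sat_rule I r"
  shows "stable_model (A \<union> C) I \<longleftrightarrow> stable_model A I"
proof -
  have "sat_program J (reduct C I)" if "J \<subseteq> I" for J
    using assms that unfolding sat_program_reduct_iff sat_rule_def sat_body_def by fastforce
  then show ?thesis
    unfolding stable_model_def reduct_Un by auto
qed

text \<open>Discarding the literals of \<open>I\<close> outside all heads makes no further positive
  body true and keeps the true part of each head, so by minimality nothing is discarded.\<close>

lemma stable_model_subset_heads:
  assumes "stable_model A I"
  shows "I \<subseteq> (\<Union>r\<in>A. fset (head r))"
proof -
  let ?J = "I \<inter> (\<Union>r\<in>A. fset (head r))"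
  have "sat_program I (reduct A I)"
    using assms by (simp add: stable_model_def)
  then have "sat_program ?J (reduct A I)"
    unfolding sat_program_reduct_iff by (simp add: disjoint_iff) meson
  then have "\<not> ?J \<subset> I"
    using assms by (simp only: stable_model_def) iprover
  then show ?thesis by blast
qed

section \<open>Soft stable models and soft weights of translations\<close>

lemma regular_part_Un: "regular_part (P \<union> R) = regular_part P \<union> regular_part R"
  by (auto simp: regular_part_def)

lemma weak_part_Un: "weak_part (P \<union> R) = weak_part P \<union> weak_part R"
  by (auto simp: weak_part_def)

lemma tau_c_Un: "tau_c (P \<union> R) = tau_c P \<union> tau_c R"
  by (auto simp: tau_c_def regular_part_Un weak_part_Un)

lemma finite_regular_part: "finite P \<Longrightarrow> finite (regular_part P)"
  unfolding regular_part_def vimage_def[symmetric] by (rule finite_vimageI) (auto intro: injI)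

lemma finite_weak_part:
  assumes "finite P"
  shows "finite (weak_part P)"
proof -
  have "weak_part P = (\<lambda>(p, n, w). Weak p n w) -` P"
    by (auto simp: weak_part_def)
  moreover have "inj (\<lambda>(p, n, w). Weak p n w)"
    by (auto simp: inj_def)
  ultimately show ?thesis
    using assms finite_vimageI by metis
qed

lemma tau_c_image:
  "tau_c P = Pair Hard ` regular_part P \<union> (\<lambda>(p, n, w). (Soft w, Rule {||} p n)) ` weak_part P"
  by (auto simp: tau_c_def image_iff)

lemma finite_tau_c: "finite P \<Longrightarrow> finite (tau_c P)"
  by (simp add: tau_c_image finite_regular_part finite_weak_part)

lemma finite_SSM:
  assumes "finite P"
  shows "finite (SSM P)"
proof (rule finite_subset)
  show "SSM P \<subseteq> Pow (\<Union>r\<in>unweighted P. fset (head r))"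
  proof
    fix I assume "I \<in> SSM P"
    then have "stable_model (unweighted (satisfied_part P I)) I"
      by (simp add: SSM_def stable_model_lpmln_def)
    then have "I \<subseteq> (\<Union>r\<in>unweighted (satisfied_part P I). fset (head r))"
      by (rule stable_model_subset_heads)
    also have "\<dots> \<subseteq> (\<Union>r\<in>unweighted P. fset (head r))"
      by (auto simp: unweighted_def satisfied_part_def)
    finally show "I \<in> Pow (\<Union>r\<in>unweighted P. fset (head r))" by blast
  qed
  show "finite (Pow (\<Union>r\<in>unweighted P. fset (head r)))"
    using assms by (simp add: unweighted_def)
qed

lemma SSM_tau_c_Un:
  "I \<in> SSM (tau_c P \<union> R) \<longleftrightarrow>
     stable_model (regular_part P \<union> unweighted (satisfied_part R I)) I \<and> sat_program I (hard_part R)"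
proof -
  let ?C = "{Rule {||} p n | p n w. (p, n, w) \<in> weak_part P \<and> sat_rule I (Rule {||} p n)}"
  let ?A = "regular_part P \<union> unweighted (satisfied_part R I)"
  have hard: "hard_part (tau_c P \<union> R) = regular_part P \<union> hard_part R"
    by (auto simp: hard_part_def tau_c_def)
  \<comment> \<open>From left to right this premise comes from the hard part, in the converse
    direction from \<open>stable_model_imp_sat\<close>.\<close>
  have "unweighted (satisfied_part (tau_c P \<union> R) I) = ?A \<union> ?C" if "sat_program I (regular_part P)"
    using that unfolding unweighted_def satisfied_part_def tau_c_def sat_program_def
    by (auto simp: image_iff) blast+
  moreover have "stable_model (?A \<union> ?C) I \<longleftrightarrow> stable_model ?A I"
    by (rule stable_model_Un_constraints) auto
  ultimately show ?thesis
    using stable_model_imp_sat[of ?A I] by (auto simp: SSM_def stable_model_lpmln_def hard)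
qed

lemma SSM_tau_c: "SSM (tau_c P) = {X. stable_model_wc P X}"
  using SSM_tau_c_Un[of _ P "{}"]
  by (auto simp: unweighted_def satisfied_part_def hard_part_def sat_program_def stable_model_wc_def)

text \<open>
  Soft constraints of \<open>R\<close> may coincide with translated weak constraints and are then counted only once
  in \<open>\<tau>\<^sup>c(P) \<union> R\<close>. Reading them back as weak constraints lets the union with \<open>P\<close> make the same
  identification; the soft rules of \<open>R\<close> with nonempty head cannot coincide with anything in \<open>\<tau>\<^sup>c(P)\<close>.
\<close>

definition weak_constraints_of :: "'a lpmln \<Rightarrow> 'a statement set" where
  "weak_constraints_of R = {Weak p n w | p n w. (Soft w, Rule {||} p n) \<in> R}"

definition headed_weight :: "'a lpmln \<Rightarrow> 'a literal set \<Rightarrow> real" where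
  "headed_weight R X = (\<Sum>(w, r) \<in> {(w, r) \<in> soft_part R. head r \<noteq> {||} \<and> sat_rule X r}. w)"

lemma finite_soft_part:
  assumes "finite R"
  shows "finite (soft_part R)"
proof -
  have "soft_part R = map_prod Soft id -` R"
    by (auto simp: soft_part_def)
  moreover have "inj (map_prod Soft id)"
    by (auto simp: inj_def)
  ultimately show ?thesis
    using assms finite_vimageI by metis
qed

lemma finite_weak_constraints_of:
  assumes "finite R"
  shows "finite (weak_constraints_of R)"
proof -
  have "weak_constraints_of R \<subseteq> (\<lambda>(w, r). Weak (pbody r) (nbody r) w) ` soft_part R"
    by (force simp: weak_constraints_of_def soft_part_def image_iff)
  then show ?thesis
    using assms finite_soft_part finite_surj by blast
qed

lemma regular_part_weak_constraints_of [simp]: "regular_part (weak_constraints_of R) = {}"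
  by (auto simp: regular_part_def weak_constraints_of_def)

text \<open>A constraint holds exactly when its body fails, so the weight collects the penalties not
  incurred; \<open>K\<close> is the sum of all penalties, the same for every
  \<open>X\<close>.\<close>

lemma W_s_tau_c_Un:
  assumes "finite P" and "finite R"
  obtains K where "\<And>X. W_s (tau_c P \<union> R) X =
    exp (K - penalty (P \<union> weak_constraints_of R) X + headed_weight R X)"
proof
  fix X
  let ?V = "weak_part (P \<union> weak_constraints_of R)"
  let ?f = "\<lambda>(p, n, w). (w, Rule {||} p n)"
  let ?S = "{(p, n, w) \<in> ?V. sat_body X p n}"
  let ?H = "{(w, r) \<in> soft_part R. head r \<noteq> {||} \<and> sat_rule X r}"
  have fin: "finite ?V"
    using assms by (simp add: finite_weak_part finite_weak_constraints_of)
  have "{(w, r) \<in> soft_part (tau_c P \<union> R). sat_rule X r} = ?f ` (?V - ?S) \<union> ?H"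
    (is "?L = ?M")
  proof (rule set_eqI)
    fix z :: "real \<times> 'a rule"
    obtain w h p n where z: "z = (w, Rule h p n)"
      by (metis prod.exhaust rule.exhaust)
    have "z \<in> ?f ` (?V - ?S) \<longleftrightarrow> h = {||} \<and> (p, n, w) \<in> ?V \<and> \<not> sat_body X p n"
      by (force simp: z image_iff)
    moreover have "z \<in> ?L \<longleftrightarrow> ((h = {||} \<and> (p, n, w) \<in> ?V) \<or> (w, Rule h p n) \<in> soft_part R)
        \<and> sat_rule X (Rule h p n)"
      by (auto simp: z soft_part_def tau_c_def weak_part_def weak_constraints_of_def)
    moreover have "z \<in> ?H \<longleftrightarrow> (w, Rule h p n) \<in> soft_part R \<and> h \<noteq> {||} \<and> sat_rule X (Rule h p n)"
      by (simp add: z)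
    moreover have "(p, n, w) \<in> ?V" if "h = {||}" "(w, Rule h p n) \<in> soft_part R"
      using that by (simp add: soft_part_def weak_part_def weak_constraints_of_def)
    moreover have "sat_rule X (Rule h p n) \<longleftrightarrow> \<not> sat_body X p n" if "h = {||}"
      using that by (simp add: sat_rule_def)
    ultimately show "z \<in> ?L \<longleftrightarrow> z \<in> ?M"
      unfolding Un_iff by argo
  qed
  moreover have "?f ` (?V - ?S) \<inter> ?H = {}"
    by auto
  moreover have "finite ?H"
    by (rule finite_subset[OF _ finite_soft_part[OF assms(2)]]) auto
  ultimately have "(\<Sum>(w, r) \<in> {(w, r) \<in> soft_part (tau_c P \<union> R). sat_rule X r}. w) =
      (\<Sum>(w, r) \<in> ?f ` (?V - ?S). w) + headed_weight R X"
    using fin by (simp add: sum.union_disjoint headed_weight_def)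
  also have "(\<Sum>(w, r) \<in> ?f ` (?V - ?S). w) = (\<Sum>(p, n, w) \<in> ?V - ?S. w)"
    by (subst sum.reindex) (auto simp: inj_on_def case_prod_beta)
  also have "\<dots> = (\<Sum>(p, n, w) \<in> ?V. w) - penalty (P \<union> weak_constraints_of R) X"
    unfolding penalty_def by (rule sum_diff[OF fin]) auto
  finally show "W_s (tau_c P \<union> R) X = exp ((\<Sum>(p, n, w) \<in> ?V. w)
      - penalty (P \<union> weak_constraints_of R) X + headed_weight R X)"
    by (simp add: W_s_def)
qed

text \<open>Summing the cross-multiplied ratios over \<open>Y\<close> produces the normalising
  sums.\<close>

lemma Pr_s_cong_ratio:
  assumes "finite (SSM P)" and "SSM P = SSM Q" and "X \<in> SSM P"
    and ratio: "\<And>Y. Y \<in> SSM P \<Longrightarrow> W_s P X * W_s Q Y = W_s Q X * W_s P Y"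
  shows "Pr_s P X = Pr_s Q X"
proof -
  have pos: "(\<Sum>Y\<in>SSM P. W_s P Y) > 0" "(\<Sum>Y\<in>SSM P. W_s Q Y) > 0"
    using assms by (auto intro!: sum_pos simp: W_s_def)
  have "W_s P X * (\<Sum>Y\<in>SSM P. W_s Q Y) = W_s Q X * (\<Sum>Y\<in>SSM P. W_s P Y)"
    by (simp add: sum_distrib_left ratio)
  then show ?thesis
    using pos assms(2) by (simp add: Pr_s_def frac_eq_eq)
qed

text \<open>Clearing denominators for \<open>X\<close> and \<open>Y\<close> and multiplying
  crosswise lets the normalising sums cancel; they are positive because \<open>SSM P\<close>
  contains \<open>X\<close>.\<close>

lemma Pr_s_eq_imp_ratio:
  assumes "finite (SSM P)" and "SSM P = SSM Q" and "X \<in> SSM P"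
    and "Pr_s P X = Pr_s Q X" and "Pr_s P Y = Pr_s Q Y"
  shows "W_s P X * W_s Q Y = W_s Q X * W_s P Y"
proof -
  have pos: "(\<Sum>Y\<in>SSM P. W_s P Y) > 0" (is "?p > 0") and pos': "(\<Sum>Y\<in>SSM P. W_s Q Y) > 0" (is "?q > 0")
    using assms by (auto intro!: sum_pos simp: W_s_def)
  have "W_s P X * ?q = W_s Q X * ?p" "W_s P Y * ?q = W_s Q Y * ?p"
    using assms(2,4,5) pos pos' by (simp_all add: Pr_s_def frac_eq_eq)
  then have "(W_s P X * ?q) * (W_s Q Y * ?p) = (W_s Q X * ?p) * (W_s P Y * ?q)"
    by simp
  then have "(W_s P X * W_s Q Y) * (?p * ?q) = (W_s Q X * W_s P Y) * (?p * ?q)"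
    by (simp only: mult_ac)
  then show ?thesis
    using pos pos' by simp
qed

section \<open>Making two models stable simultaneously\<close>

definition rule_literals :: "'a rule \<Rightarrow> 'a literal set" where
  "rule_literals r = fset (head r) \<union> fset (pbody r) \<union> fset (nbody r)"

primrec statement_literals :: "'a statement \<Rightarrow> 'a literal set" where
  "statement_literals (Regular r) = rule_literals r"
| "statement_literals (Weak p n w) = fset p \<union> fset n"

lemma finite_statement_literals: "finite (statement_literals s)"
  by (cases s) (auto simp: rule_literals_def)

lemma sat_program_insert:
  assumes "l \<notin> \<Union>(rule_literals ` A)"
  shows "sat_program (insert l X) A \<longleftrightarrow> sat_program X A"
  using assms unfolding sat_program_def sat_rule_def sat_body_def rule_literals_def by auto

lemma penalty_insert:
  assumes "l \<notin> \<Union>(statement_literals ` P)"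
  shows "penalty P (insert l X) = penalty P X"
proof -
  have "{(p, n, w) \<in> weak_part P. sat_body (insert l X) p n} =
      {(p, n, w) \<in> weak_part P. sat_body X p n}"
    using assms unfolding weak_part_def sat_body_def by fastforce
  then show ?thesis by (simp add: penalty_def)
qed

definition selector :: "'a \<Rightarrow> 'a literal set \<Rightarrow> 'a \<Rightarrow> 'a literal set \<Rightarrow> 'a rule set" where
  "selector b X c Y =
     {Rule {|Pos b|} {||} {|Pos c|}, Rule {|Pos c|} {||} {|Pos b|}} \<union>
     (\<lambda>x. Rule {|x|} {|Pos b|} {||}) ` X \<union> (\<lambda>y. Rule {|y|} {|Pos c|} {||}) ` Y"

lemma selector_commute: "selector b X c Y = selector c Y b X"
  by (auto simp: selector_def)

text \<open>Minimality comes from the selector alone: as \<open>Pos c\<close> is false, the reduct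
  has \<open>Pos b\<close> as a fact, and the rules with body \<open>Pos b\<close> force all of
  \<open>X\<close> into any submodel.\<close>

lemma stable_model_selector:
  assumes "interpretation_set X" and "sat_program X A"
    and "b \<noteq> c" and "Neg b \<notin> X" and "Pos c \<notin> X"
    and "Pos b \<notin> \<Union>(rule_literals ` A)"
  shows "stable_model (A \<union> selector b X c Y) (insert (Pos b) X)"
    (is "stable_model _ ?I")
  unfolding stable_model_def
proof (intro conjI allI impI notI)
  show "interpretation_set ?I"
    using assms by (auto simp: interpretation_set_def)
  have "sat_program ?I (selector b X c Y)"
    using assms by (auto simp: sat_program_def sat_rule_def sat_body_def selector_def)
  then show "sat_program ?I (reduct (A \<union> selector b X c Y) ?I)"
    using assms by (simp add: sat_program_reduct_self sat_program_insert)
next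
  fix J
  assume "J \<subset> ?I" and "sat_program J (reduct (A \<union> selector b X c Y) ?I)"
  then have "sat_program J (reduct (selector b X c Y) ?I)"
    by (simp add: reduct_Un)
  then have "Pos b \<in> J" and "Pos b \<in> J \<Longrightarrow> X \<subseteq> J"
    using assms(3,5) unfolding sat_program_reduct_iff selector_def by (auto simp: ball_Un)
  then show False
    using \<open>J \<subset> ?I\<close> by auto
qed

text \<open>Both signs are avoided: \<open>Pos a\<close> must be new to the programs, and
  \<open>Neg a\<close> must not clash with it in a model.\<close>

lemma fresh_atom:
  assumes "infinite (UNIV :: 'a set)" and "finite (L :: 'a literal set)"
  obtains a where "Pos a \<notin> L" and "Neg a \<notin> L"
proof -
  have "finite (Pos -` L \<union> Neg -` L)"
    using assms(2) by (simp add: finite_vimageI inj_def)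
  from ex_new_if_finite[OF assms(1) this] show ?thesis
    using that by auto
qed

text \<open>Carries the penalty condition from stable models over to arbitrary models of the rules
  of \<open>P\<close>; finiteness of \<open>X\<close> and \<open>Y\<close> makes the selector a
  finite program.\<close>

lemma strongly_equivalent_wc_penalty_diff:
  fixes P Q W :: "'a statement set"
  assumes inf: "infinite (UNIV :: 'a set)"
    and fin: "finite P" "finite Q" "finite W" "finite X" "finite Y"
    and W: "regular_part W = {}"
    and equiv: "strongly_equivalent_wc P Q"
    and X: "interpretation_set X" "sat_program X (regular_part P)"
    and Y: "interpretation_set Y" "sat_program Y (regular_part P)"
  shows "penalty (P \<union> W) X - penalty (P \<union> W) Y = penalty (Q \<union> W) X - penalty (Q \<union> W) Y"
proof -
  define L where "L = \<Union>(statement_literals ` (P \<union> Q \<union> W)) \<union> X \<union> Y"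
  have finL: "finite L"
    using fin by (simp add: L_def finite_statement_literals)
  obtain b where b: "Pos b \<notin> L" "Neg b \<notin> L"
    using fresh_atom[OF inf finL] .
  have "finite (insert (Pos b) L)"
    using finL by simp
  \<comment> \<open>Avoiding \<open>Pos b\<close> as well makes \<open>c\<close> differ from
    \<open>b\<close>.\<close>
  then obtain c where c: "Pos c \<notin> insert (Pos b) L" "Neg c \<notin> insert (Pos b) L"
    using fresh_atom[OF inf] by blast
  define S where "S = Regular ` selector b X c Y"
  define R where "R = W \<union> S"
  have finR: "finite R"
    using fin by (simp add: R_def S_def selector_def)
  have regular: "regular_part (P \<union> R) = regular_part P \<union> selector b X c Y"
    using W by (auto simp: R_def S_def regular_part_def)
  have "\<Union>(rule_literals ` regular_part P) \<subseteq> L"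
    by (force simp: L_def regular_part_def)
  then have lit: "Pos b \<notin> \<Union>(rule_literals ` regular_part P)" "Pos c \<notin> \<Union>(rule_literals ` regular_part P)"
    using b c by blast+
  have sub: "X \<subseteq> L" "Y \<subseteq> L"
    by (auto simp: L_def)
  have "stable_model_wc (P \<union> R) (insert (Pos b) X)"
    unfolding stable_model_wc_def regular
    by (rule stable_model_selector) (use X b c lit sub in auto)
  moreover have "stable_model_wc (P \<union> R) (insert (Pos c) Y)"
    unfolding stable_model_wc_def regular selector_commute[of b]
    by (rule stable_model_selector) (use Y b c lit sub in auto)
  ultimately have "penalty (P \<union> R) (insert (Pos b) X) - penalty (P \<union> R) (insert (Pos c) Y) =
      penalty (Q \<union> R) (insert (Pos b) X) - penalty (Q \<union> R) (insert (Pos c) Y)"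
    using equiv finR unfolding strongly_equivalent_wc_def by blast
  moreover have "penalty (T \<union> R) Z = penalty (T \<union> W) Z" for T Z
  proof -
    have "weak_part (T \<union> R) = weak_part (T \<union> W)"
      by (auto simp: R_def S_def weak_part_def)
    then show ?thesis by (simp add: penalty_def)
  qed
  moreover have "penalty (T \<union> W) (insert (Pos b) X) = penalty (T \<union> W) X"
    "penalty (T \<union> W) (insert (Pos c) Y) = penalty (T \<union> W) Y" if "T \<in> {P, Q}" for T
    using that b c by (auto intro!: penalty_insert simp: L_def)
  ultimately show ?thesis by simp
qed

section \<open>The equivalence\<close>

text \<open>Contexts of the form \<open>tau_c R\<close> are enough, since \<open>tau_c\<close>
  commutes with unions; comparing exponents in the weight ratios gives the penalty
  differences.\<close>

lemma sp_strongly_equivalent_imp_strongly_equivalent_wc: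
  assumes fin: "finite P" "finite Q"
    and equiv: "sp_strongly_equivalent (tau_c P) (tau_c Q)"
  shows "strongly_equivalent_wc P Q"
  unfolding strongly_equivalent_wc_def
proof (intro allI impI conjI)
  fix R :: "'a statement set" assume R: "finite R"
  have ssm: "SSM (tau_c (P \<union> R)) = SSM (tau_c (Q \<union> R))"
    and pr: "\<And>X. X \<in> SSM (tau_c (P \<union> R)) \<Longrightarrow> Pr_s (tau_c (P \<union> R)) X = Pr_s (tau_c (Q \<union> R)) X"
    using equiv finite_tau_c[OF R] unfolding sp_strongly_equivalent_def tau_c_Un by auto
  show "stable_model_wc (P \<union> R) X \<longleftrightarrow> stable_model_wc (Q \<union> R) X" for X
    using ssm by (auto simp: SSM_tau_c)
  fix X Y assume "stable_model_wc (P \<union> R) X \<and> stable_model_wc (P \<union> R) Y"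
  then have XY: "X \<in> SSM (tau_c (P \<union> R))" "Y \<in> SSM (tau_c (P \<union> R))"
    by (simp_all add: SSM_tau_c)
  \<comment> \<open>The empty context contributes neither headed soft rules nor weak
    constraints.\<close>
  have weight: "\<exists>K. \<forall>Z. W_s (tau_c T) Z = exp (K - penalty T Z)" if "finite T" for T :: "'a statement set"
    by (rule W_s_tau_c_Un[OF that, of "{}"])
      (auto simp: weak_constraints_of_def headed_weight_def soft_part_def)
  obtain K where K: "\<And>Z. W_s (tau_c (P \<union> R)) Z = exp (K - penalty (P \<union> R) Z)"
    using weight[of "P \<union> R"] fin R by auto
  obtain K' where K': "\<And>Z. W_s (tau_c (Q \<union> R)) Z = exp (K' - penalty (Q \<union> R) Z)"
    using weight[of "Q \<union> R"] fin R by auto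
  have "finite (SSM (tau_c (P \<union> R)))"
    using fin R by (intro finite_SSM finite_tau_c) simp
  from Pr_s_eq_imp_ratio[OF this ssm XY(1) pr[OF XY(1)] pr[OF XY(2)]]
  show "penalty (P \<union> R) X - penalty (P \<union> R) Y = penalty (Q \<union> R) X - penalty (Q \<union> R) Y"
    by (simp add: K K' flip: exp_add)
qed

text \<open>For each candidate \<open>I\<close> separately, the rules of \<open>R\<close> that
  \<open>I\<close> satisfies serve as a context of regular rules.\<close>

lemma strongly_equivalent_wc_imp_SSM_eq:
  assumes "strongly_equivalent_wc P Q" and "finite R"
  shows "SSM (tau_c P \<union> R) = SSM (tau_c Q \<union> R)"
proof -
  have "stable_model (regular_part P \<union> B) I \<longleftrightarrow> stable_model (regular_part Q \<union> B) I"
    if "finite B" for B I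
  proof -
    have "regular_part (T \<union> Regular ` B) = regular_part T \<union> B" for T
      by (auto simp: regular_part_def)
    moreover have "finite (Regular ` B)"
      using that by simp
    ultimately show ?thesis
      using assms(1) unfolding strongly_equivalent_wc_def stable_model_wc_def by metis
  qed
  moreover have "finite (unweighted (satisfied_part R I))" for I
    unfolding unweighted_def satisfied_part_def
    by (rule finite_imageI, rule finite_subset[OF _ assms(2)]) auto
  ultimately show ?thesis
    by (intro set_eqI) (simp add: SSM_tau_c_Un)
qed

text \<open>Collects what \<open>strongly_equivalent_wc_penalty_diff\<close> asks of the two
  models.\<close>

lemma SSM_tau_c_Un_model:
  assumes "finite P" and "finite R" and "X \<in> SSM (tau_c P \<union> R)"
  shows "finite X" and "interpretation_set X" and "sat_program X (regular_part P)"
proof -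
  let ?A = "regular_part P \<union> unweighted (satisfied_part R X)"
  have st: "stable_model ?A X"
    using assms(3) by (simp add: SSM_tau_c_Un)
  have "finite (satisfied_part R X)"
    by (rule finite_subset[OF _ assms(2)]) (auto simp: satisfied_part_def)
  then have "finite (\<Union>r\<in>?A. fset (head r))"
    using assms(1) by (simp add: finite_regular_part unweighted_def)
  then show "finite X"
    using stable_model_subset_heads[OF st] finite_subset by blast
  show "interpretation_set X"
    using st by (simp add: stable_model_def)
  show "sat_program X (regular_part P)"
    using stable_model_imp_sat[OF st] by simp
qed

lemma strongly_equivalent_wc_imp_sp_strongly_equivalent:
  fixes P Q :: "'a statement set"
  assumes inf: "infinite (UNIV :: 'a set)"
    and fin: "finite P" "finite Q"
    and equiv: "strongly_equivalent_wc P Q"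
  shows "sp_strongly_equivalent (tau_c P) (tau_c Q)"
  unfolding sp_strongly_equivalent_def
proof (intro allI impI conjI ballI)
  fix R :: "'a lpmln" assume R: "finite R"
  let ?W = "weak_constraints_of R"
  show ssm: "SSM (tau_c P \<union> R) = SSM (tau_c Q \<union> R)"
    using equiv R by (rule strongly_equivalent_wc_imp_SSM_eq)
  fix X assume X: "X \<in> SSM (tau_c P \<union> R)"
  show "Pr_s (tau_c P \<union> R) X = Pr_s (tau_c Q \<union> R) X"
  proof (rule Pr_s_cong_ratio[OF _ ssm X])
    show "finite (SSM (tau_c P \<union> R))"
      using fin R by (simp add: finite_SSM finite_tau_c)
    fix Y assume Y: "Y \<in> SSM (tau_c P \<union> R)"
    note mX = SSM_tau_c_Un_model[OF fin(1) R X] and mY = SSM_tau_c_Un_model[OF fin(1) R Y]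
    have pen: "penalty (P \<union> ?W) X - penalty (P \<union> ?W) Y = penalty (Q \<union> ?W) X - penalty (Q \<union> ?W) Y"
      by (rule strongly_equivalent_wc_penalty_diff[OF inf fin finite_weak_constraints_of[OF R]
            mX(1) mY(1) regular_part_weak_constraints_of equiv mX(2,3) mY(2,3)])
    obtain K where K: "\<And>Z. W_s (tau_c P \<union> R) Z = exp (K - penalty (P \<union> ?W) Z + headed_weight R Z)"
      using W_s_tau_c_Un[OF fin(1) R] by blast
    obtain K' where K': "\<And>Z. W_s (tau_c Q \<union> R) Z = exp (K' - penalty (Q \<union> ?W) Z + headed_weight R Z)"
      using W_s_tau_c_Un[OF fin(2) R] by blast
    \<comment> \<open>In the exponents, \<open>K\<close>, \<open>K'\<close> and the headed weights
      of \<open>X\<close> and \<open>Y\<close> occur once on each side, which leaves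
      \<open>pen\<close>.\<close>
    show "W_s (tau_c P \<union> R) X * W_s (tau_c Q \<union> R) Y = W_s (tau_c Q \<union> R) X * W_s (tau_c P \<union> R) Y"
      using pen by (simp add: K K' algebra_simps flip: exp_add)
  qed
qed

theorem theorem6p4:
  fixes P Q :: "'a statement set"
  assumes "infinite (UNIV :: 'a set)"
    and "finite P" and "finite Q"
  shows "strongly_equivalent_wc P Q \<longleftrightarrow> sp_strongly_equivalent (tau_c P) (tau_c Q)"
  using strongly_equivalent_wc_imp_sp_strongly_equivalent[OF assms]
    sp_strongly_equivalent_imp_strongly_equivalent_wc[OF assms(2,3)] by (rule iffI)

end
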